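(* Let $(\Omega,\mathcal A)$ be a measurable space and let $K:\Omega\to\mathcal K'(\mathbb{C}^n)$ be a random compact set in $\mathbb{C}^n$. Then its polynomially convex hull $\widehat K$, defined pointwise as $\widehat K(\omega):=\widehat{K(\omega)}$ for $\omega\in\Omega$, is a random compact set.
   Context: $\mathcal K'(\mathbb{C}^n)$ denotes the space of non-empty compact subsets of $\mathbb{C}^n$ with the Hausdorff distance and its Borel $\sigma$-algebra. A random compact set in $\mathbb{C}^n$ is a measurable function $\Omega\to\mathcal K'(\mathbb{C}^n)$. For $Q\in\mathcal K'(\mathbb{C}^n)$, the polynomially convex hull is $\widehat Q=\{z\in\mathbb{C}^n:|p(z)|\le\max_{x\in Q}|p(x)|\text{ for all }p\in P(\mathbb{C}^n)\}$, where $P(\mathbb{C}^n)$ is the set of complex polynomials from $\mathbb{C}^n$ to $\mathbb{C}$. *)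

theory Defs
  imports "HOL-Analysis.Analysis"
begin

definition nonempty_compacts :: "'a::metric_space set set" where
  "nonempty_compacts = {Q. compact Q \<and> Q \<noteq> {}}"

text \<open>The value 0 for empty or unbounded arguments is a dummy: it makes the function nonnegative
  everywhere, as the locale \<^locale>\<open>Metric_space\<close> demands even outside the carrier.\<close>

definition hausdorff_distance :: "'a::metric_space set \<Rightarrow> 'a set \<Rightarrow> real" where
  "hausdorff_distance A B =
     (if A = {} \<or> B = {} \<or> \<not> bounded A \<or> \<not> bounded B then 0
      else max (SUP a\<in>A. infdist a B) (SUP b\<in>B. infdist b A))"

lemma bdd_above_infdist_image:
  assumes "bounded A"
  shows "bdd_above ((\<lambda>a. infdist a B) ` A)"
proof (cases "A = {}")
  case False
  then obtain x where x: "x \<in> A" by blast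
  obtain e where e: "\<And>y. y \<in> A \<Longrightarrow> dist x y \<le> e"
    using assms bounded_any_center by metis
  have "infdist y B \<le> infdist x B + e" if "y \<in> A" for y
    using infdist_triangle[of y B x] e[OF that] by (simp add: dist_commute)
  then show ?thesis by (intro bdd_aboveI2)
qed simp

lemma hausdorff_distance_le_iff:
  assumes "A \<in> nonempty_compacts" "B \<in> nonempty_compacts"
  shows "hausdorff_distance A B \<le> r \<longleftrightarrow>
    (\<forall>a\<in>A. infdist a B \<le> r) \<and> (\<forall>b\<in>B. infdist b A \<le> r)"
  using assms
  by (simp add: hausdorff_distance_def nonempty_compacts_def compact_imp_bounded
        cSUP_le_iff bdd_above_infdist_image)

lemma hausdorff_distance_nonneg: "0 \<le> hausdorff_distance A B"
proof (cases "A = {} \<or> B = {} \<or> \<not> bounded A \<or> \<not> bounded B")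
  case False
  then obtain a where "a \<in> A" by blast
  then have "0 \<le> (SUP a\<in>A. infdist a B)"
    using False by (intro cSUP_upper2[OF bdd_above_infdist_image]) (auto simp: infdist_nonneg)
  then show ?thesis using False by (simp add: hausdorff_distance_def le_max_iff_disj)
qed (simp add: hausdorff_distance_def)

lemma infdist_hausdorff_trans:
  assumes "\<forall>a\<in>A. infdist a B \<le> r" "\<forall>b\<in>B. infdist b C \<le> s"
    and B: "B \<in> nonempty_compacts" and "a \<in> A"
  shows "infdist a C \<le> r + s"
proof -
  have ne: "B \<noteq> {}" using B by (simp add: nonempty_compacts_def)
  have "infdist a C - s \<le> (INF b\<in>B. dist a b)"
  proof (rule cINF_greatest[OF ne])
    fix b assume "b \<in> B"
    then show "infdist a C - s \<le> dist a b"
      using assms(2) infdist_triangle[of a C b] by fastforce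
  qed
  then show ?thesis
    using bspec[OF assms(1) \<open>a \<in> A\<close>] infdist_notempty[OF ne, of a] by linarith
qed

interpretation Hausdorff: Metric_space nonempty_compacts hausdorff_distance
proof
  fix A B C :: "'a set"
  show "0 \<le> hausdorff_distance A B" by (rule hausdorff_distance_nonneg)
  show "hausdorff_distance A B = hausdorff_distance B A"
    by (auto simp: hausdorff_distance_def max.commute)
  assume A: "A \<in> nonempty_compacts" and B: "B \<in> nonempty_compacts"
  have "hausdorff_distance A B = 0 \<longleftrightarrow> hausdorff_distance A B \<le> 0"
    using hausdorff_distance_nonneg[of A B] by auto
  also have "\<dots> \<longleftrightarrow> (\<forall>a\<in>A. a \<in> B) \<and> (\<forall>b\<in>B. b \<in> A)"
  proof -
    have "infdist x S \<le> 0 \<longleftrightarrow> x \<in> S" if "S \<in> nonempty_compacts" for x and S :: "'a set"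
      using that in_closed_iff_infdist_zero[of S x] infdist_nonneg[of x S]
      by (auto simp: nonempty_compacts_def compact_imp_closed)
    then show ?thesis using A B by (simp add: hausdorff_distance_le_iff)
  qed
  finally show "hausdorff_distance A B = 0 \<longleftrightarrow> A = B" by blast
  assume C: "C \<in> nonempty_compacts"
  have AB: "\<forall>a\<in>A. infdist a B \<le> hausdorff_distance A B"
           "\<forall>b\<in>B. infdist b A \<le> hausdorff_distance A B"
    using hausdorff_distance_le_iff[OF A B] by blast+
  have BC: "\<forall>b\<in>B. infdist b C \<le> hausdorff_distance B C"
           "\<forall>c\<in>C. infdist c B \<le> hausdorff_distance B C"
    using hausdorff_distance_le_iff[OF B C] by blast+
  show "hausdorff_distance A C \<le> hausdorff_distance A B + hausdorff_distance B C"
    unfolding hausdorff_distance_le_iff[OF A C]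
    using infdist_hausdorff_trans[OF AB(1) BC(1) B]
      infdist_hausdorff_trans[OF BC(2) AB(2) B] by (auto simp: add.commute)
qed

definition hausdorff_borel :: "'a::metric_space set measure" where
  "hausdorff_borel = sigma nonempty_compacts {U. openin Hausdorff.mtopology U}"

lemma space_hausdorff_borel [simp]: "space hausdorff_borel = nonempty_compacts"
  unfolding hausdorff_borel_def
  by (intro space_measure_of) (auto simp: Hausdorff.openin_mtopology)

lemma sets_hausdorff_borel:
  "sets hausdorff_borel = sigma_sets nonempty_compacts {U. openin Hausdorff.mtopology U}"
  unfolding hausdorff_borel_def
  by (intro sets_measure_of) (auto simp: Hausdorff.openin_mtopology)

text \<open>Only the measurable space underlying \<open>M\<close> matters here. Measurability includes
  that \<open>K \<omega>\<close> is a nonempty compact set for every \<open>\<omega> \<in> space M\<close>.\<close>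

definition random_compact_set :: "'w measure \<Rightarrow> ('w \<Rightarrow> 'a::metric_space set) \<Rightarrow> bool" where
  "random_compact_set M K \<longleftrightarrow> K \<in> measurable M hausdorff_borel"

text \<open>Polynomials in the coordinates \<open>z $ i\<close>; \<open>E\<close> is a finite set of multi-indices.\<close>

definition complex_polynomials :: "(complex ^ 'n \<Rightarrow> complex) set" where
  "complex_polynomials =
     {p. \<exists>(E :: ('n \<Rightarrow> nat) set) c. finite E \<and>
           p = (\<lambda>z. \<Sum>\<alpha>\<in>E. c \<alpha> * (\<Prod>i\<in>UNIV. (z $ i) ^ \<alpha> i))}"

text \<open>For nonempty compact \<open>Q\<close> the supremum below is a maximum, since polynomials are continuous.\<close>

definition polynomial_hull :: "(complex ^ 'n) set \<Rightarrow> (complex ^ 'n) set" where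
  "polynomial_hull Q =
     {z. \<forall>p\<in>complex_polynomials. cmod (p z) \<le> (SUP x\<in>Q. cmod (p x))}"

lemma continuous_on_complex_polynomials:
  "p \<in> complex_polynomials \<Longrightarrow> continuous_on S p"
  by (auto simp: complex_polynomials_def intro!: continuous_intros)

lemma SUP_cmod_polynomial_attained:
  assumes "Q \<in> nonempty_compacts" "p \<in> complex_polynomials"
  shows "\<exists>x\<in>Q. (SUP x\<in>Q. cmod (p x)) = cmod (p x) \<and> (\<forall>y\<in>Q. cmod (p y) \<le> cmod (p x))"
proof -
  have "continuous_on Q (\<lambda>x. cmod (p x))"
    using assms(2) by (intro continuous_on_norm continuous_on_complex_polynomials)
  then obtain x where x: "x \<in> Q" "\<forall>y\<in>Q. cmod (p y) \<le> cmod (p x)"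
    using continuous_attains_sup[of Q "\<lambda>x. cmod (p x)"] assms(1)
    by (auto simp: nonempty_compacts_def)
  then have "(SUP x\<in>Q. cmod (p x)) = cmod (p x)"
    by (intro cSup_eq_maximum) auto
  then show ?thesis using x by blast
qed

end

theory Submission
  imports Defs
begin

text \<open>The hull is upper semicontinuous: if \<open>polynomial_hull Q\<close> misses a compact set \<open>C\<close>, then by
  compactness finitely many polynomials separate \<open>Q\<close> from all points of \<open>C\<close>, and the same
  polynomials work for every compact set near \<open>Q\<close>. So the event that the hull hits \<open>C\<close> is closed.
  Since the Hausdorff metric is separable, with the finite subsets of a countable dense set as a
  dense family, and closed balls around finite sets are described by hitting conditions, these
  events determine measurability.\<close>

text \<open>A compact subset of \<open>W\<close> has a uniform \<open>e\<close>-neighbourhood inside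
  \<open>W\<close>, and every compact set at Hausdorff distance less than \<open>e\<close> stays in
  that neighbourhood.\<close>

lemma openin_nonempty_compacts_subset:
  assumes "open W"
  shows "openin Hausdorff.mtopology {Q \<in> nonempty_compacts. Q \<subseteq> W}"
  unfolding Hausdorff.openin_mtopology
proof (intro conjI allI impI)
  fix Q :: "'a set" assume "Q \<in> {Q \<in> nonempty_compacts. Q \<subseteq> W}"
  then have Q: "Q \<in> nonempty_compacts" "compact Q" "Q \<noteq> {}" "Q \<subseteq> W"
    by (auto simp: nonempty_compacts_def)
  obtain e where e: "e > 0" "(\<Union>x\<in>Q. ball x e) \<subseteq> W"
    using compact_subset_open_imp_ball_epsilon_subset[OF \<open>compact Q\<close> assms \<open>Q \<subseteq> W\<close>] by blast
  have "R \<subseteq> W" if R: "R \<in> nonempty_compacts" "hausdorff_distance Q R < e" for R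
  proof
    fix x assume "x \<in> R"
    then have "infdist x Q < e"
      using hausdorff_distance_le_iff[OF Q(1) R(1), of "hausdorff_distance Q R"] R(2) by force
    then obtain y where "y \<in> Q" "dist x y < e"
      using \<open>Q \<noteq> {}\<close> cInf_lessD[of "dist x ` Q" e] by (auto simp: infdist_notempty)
    then show "x \<in> W"
      using e(2) by (metis UN_I dist_commute mem_ball subsetD)
  qed
  then show "\<exists>r>0. Hausdorff.mball Q r \<subseteq> {Q \<in> nonempty_compacts. Q \<subseteq> W}"
    using e(1) unfolding Hausdorff.mball_def by blast
qed auto

text \<open>Compactness extracts a finite cover of \<open>Q\<close> by \<open>e\<close>-balls
  centred in the dense set \<open>D\<close>; the centres of those balls that meet \<open>Q\<close>
  form the approximation.\<close>

lemma finite_approximation_nonempty_compacts: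
  fixes Q D :: "'a::metric_space set"
  assumes Q: "Q \<in> nonempty_compacts" and "0 < e"
    and dense: "\<And>U::'a set. open U \<Longrightarrow> U \<noteq> {} \<Longrightarrow> \<exists>d\<in>D. d \<in> U"
  obtains F where "F \<subseteq> D" "finite F" "F \<in> nonempty_compacts" "hausdorff_distance F Q \<le> e"
proof -
  have Q': "compact Q" "Q \<noteq> {}" using Q by (auto simp: nonempty_compacts_def)
  have "Q \<subseteq> (\<Union>d\<in>D. ball d e)"
  proof
    fix x assume "x \<in> Q"
    obtain d where "d \<in> D" "d \<in> ball x e"
      using dense[of "ball x e"] \<open>0 < e\<close> by auto
    then show "x \<in> (\<Union>d\<in>D. ball d e)" by (auto simp: dist_commute)
  qed
  then obtain G where G: "G \<subseteq> D" "finite G" "Q \<subseteq> (\<Union>d\<in>G. ball d e)"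
    using compactE_image[OF \<open>compact Q\<close>, of D "\<lambda>d. ball d e"] by auto
  \<comment> \<open>A ball missing \<open>Q\<close> may have its centre far from \<open>Q\<close>.
    Dropping it keeps the cover and puts every remaining centre within \<open>e\<close> of
    \<open>Q\<close>.\<close>
  define F where "F = {d \<in> G. ball d e \<inter> Q \<noteq> {}}"
  have cover: "\<exists>d\<in>F. dist x d < e" if "x \<in> Q" for x
    using G(3) that by (force simp: F_def dist_commute)
  have F: "finite F" "F \<in> nonempty_compacts"
    using G(2) cover Q'(2) by (auto simp: nonempty_compacts_def F_def intro!: finite_imp_compact) blast
  have "\<forall>a\<in>F. infdist a Q \<le> e"
    by (auto simp: F_def intro: infdist_le2 less_imp_le)
  moreover have "\<forall>b\<in>Q. infdist b F \<le> e"
    using cover by (meson infdist_le2 less_imp_le)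
  ultimately have "hausdorff_distance F Q \<le> e"
    using hausdorff_distance_le_iff[OF F(2) Q] by blast
  with F G(1) that[of F] show ?thesis by (auto simp: F_def)
qed

text \<open>Finite subsets of a countable dense set as centres and rational radii give only
  countably many balls. Closed balls are used because their non-strict inequalities become hitting
  conditions for compact sets.\<close>

lemma openin_hausdorff_eq_countable_Union:
  fixes \<U> :: "'a::{metric_space, second_countable_topology} set set"
  assumes "openin Hausdorff.mtopology \<U>"
  obtains \<F> :: "('a set \<times> real) set" where "countable \<F>"
    "\<And>F r. (F, r) \<in> \<F> \<Longrightarrow> finite F \<and> F \<in> nonempty_compacts"
    "\<U> = (\<Union>(F, r)\<in>\<F>. Hausdorff.mcball F r)"
proof -
  obtain D :: "'a set" where D: "countable D" "\<And>U::'a set. open U \<Longrightarrow> U \<noteq> {} \<Longrightarrow> \<exists>d\<in>D. d \<in> U"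
    using countable_dense_exists by metis
  define \<F> where "\<F> = {(F, r) \<in> {F. finite F \<and> F \<subseteq> D} \<times> \<rat>.
    F \<in> nonempty_compacts \<and> Hausdorff.mcball F r \<subseteq> \<U>}"
  have "countable \<F>"
    unfolding \<F>_def
    by (rule countable_subset[OF _ countable_SIGMA[OF countable_Collect_finite_subset[OF D(1)] countable_rat]]) auto
  moreover have "\<U> = (\<Union>(F, r)\<in>\<F>. Hausdorff.mcball F r)"
  proof (intro equalityI subsetI)
    fix Q assume "Q \<in> \<U>"
    then obtain e where Q: "Q \<in> nonempty_compacts" and e: "e > 0" "Hausdorff.mball Q e \<subseteq> \<U>"
      using assms unfolding Hausdorff.openin_mtopology by blast
    \<comment> \<open>With \<open>r < e / 2\<close>, a set within \<open>r\<close> of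
      \<open>F\<close> is within \<open>r + r < e\<close> of \<open>Q\<close>.\<close>
    obtain r where r: "r \<in> \<rat>" "0 < r" "r < e / 2"
      using Rats_dense_in_real[of 0 "e / 2"] e(1) by auto
    obtain F where F: "F \<subseteq> D" "finite F" "F \<in> nonempty_compacts" "hausdorff_distance F Q \<le> r"
      using finite_approximation_nonempty_compacts[OF Q r(2) D(2)] by blast
    have "Hausdorff.mcball F r \<subseteq> Hausdorff.mball Q e"
    proof
      fix R assume "R \<in> Hausdorff.mcball F r"
      then have R: "R \<in> nonempty_compacts" "hausdorff_distance F R \<le> r"
        by (auto simp: Hausdorff.in_mcball)
      have "hausdorff_distance Q R \<le> hausdorff_distance Q F + hausdorff_distance F R"
        by (rule Hausdorff.triangle[OF Q F(3) R(1)])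
      then show "R \<in> Hausdorff.mball Q e"
        using R Q F(4) r(3) Hausdorff.commute[of F Q] by (simp add: Hausdorff.in_mball)
    qed
    then have "(F, r) \<in> \<F>" using F r e by (auto simp: \<F>_def)
    moreover have "Q \<in> Hausdorff.mcball F r"
      using F Q by (simp add: Hausdorff.in_mcball)
    ultimately show "Q \<in> (\<Union>(F, r)\<in>\<F>. Hausdorff.mcball F r)" by blast
  qed (auto simp: \<F>_def)
  moreover have "finite F \<and> F \<in> nonempty_compacts" if "(F, r) \<in> \<F>" for F r
    using that by (simp add: \<F>_def)
  ultimately show ?thesis using that by blast
qed

text \<open>Countable unions reduce the claim to preimages of closed balls around finite sets
  \<open>F\<close>. Such a preimage combines finitely many events of hitting a compact ball with the
  event of missing an open set.\<close>

lemma measurable_hausdorff_borelI: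
  fixes h :: "'w \<Rightarrow> 'a::euclidean_space set"
  assumes nc: "\<And>w. w \<in> space M \<Longrightarrow> h w \<in> nonempty_compacts"
    and hit: "\<And>C. compact C \<Longrightarrow> {w \<in> space M. h w \<inter> C \<noteq> {}} \<in> sets M"
  shows "h \<in> measurable M hausdorff_borel"
  unfolding hausdorff_borel_def
proof (rule measurable_measure_of)
  show "{U. openin Hausdorff.mtopology U} \<subseteq> Pow nonempty_compacts"
    by (auto simp: Hausdorff.openin_mtopology)
  show "h \<in> space M \<rightarrow> nonempty_compacts" using nc by blast
  \<comment> \<open>In a Euclidean space an open set is a countable union of compact sets, so
    hitting it is a countable union of the given events.\<close>
  have hit_open: "{w \<in> space M. h w \<inter> W \<noteq> {}} \<in> sets M" if "open W" for W :: "'a set"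
  proof -
    obtain C :: "nat \<Rightarrow> 'a set" where C: "\<And>n. compact (C n)" "\<Union>(range C) = W"
      using open_Union_compact_subsets[OF \<open>open W\<close>] by metis
    have "{w \<in> space M. h w \<inter> W \<noteq> {}} = (\<Union>n. {w \<in> space M. h w \<inter> C n \<noteq> {}})"
      using C(2) by auto
    then show ?thesis using hit[OF C(1)] by auto
  qed
  have ball: "h -` Hausdorff.mcball F r \<inter> space M \<in> sets M"
    if F: "finite F" "F \<in> nonempty_compacts" for F r
  proof -
    let ?W = "{x. r < infdist x F}"
    have "open ?W" by (intro open_Collect_less continuous_intros)
    \<comment> \<open>The distance to the closed set \<open>h w\<close> is attained, which makes
      this exact even when it equals \<open>r\<close>.\<close>
    have infdist_iff: "infdist b (h w) \<le> r \<longleftrightarrow> h w \<inter> cball b r \<noteq> {}" if "w \<in> space M" for b w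
    proof
      have *: "closed (h w)" "h w \<noteq> {}"
        using nc[OF that] by (auto simp: nonempty_compacts_def compact_imp_closed)
      show "h w \<inter> cball b r \<noteq> {}" if "infdist b (h w) \<le> r"
      proof -
        obtain x where "x \<in> h w" "infdist b (h w) = dist b x"
          using infdist_attains_inf[OF *] by metis
        with that show ?thesis by (auto simp: disjoint_iff)
      qed
      show "infdist b (h w) \<le> r" if "h w \<inter> cball b r \<noteq> {}"
        using that by (auto intro: infdist_le2)
    qed
    \<comment> \<open>The two halves of the Hausdorff distance: each point of \<open>F\<close> is
      within \<open>r\<close> of \<open>h w\<close>, and no point of \<open>h w\<close> is farther
      than \<open>r\<close> from \<open>F\<close>.\<close>
    have "h -` Hausdorff.mcball F r \<inter> space M =
      {w \<in> space M. \<forall>b\<in>F. h w \<inter> cball b r \<noteq> {}} - {w \<in> space M. h w \<inter> ?W \<noteq> {}}"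
    proof -
      have "h w \<in> Hausdorff.mcball F r \<longleftrightarrow> (\<forall>b\<in>F. h w \<inter> cball b r \<noteq> {}) \<and> h w \<inter> ?W = {}"
        if "w \<in> space M" for w
        unfolding infdist_iff[OF that, symmetric]
        by (auto simp: Hausdorff.in_mcball hausdorff_distance_le_iff F(2) nc[OF that]
            disjoint_iff not_less)
      then show ?thesis by blast
    qed
    moreover have "{w \<in> space M. \<forall>b\<in>F. h w \<inter> cball b r \<noteq> {}} \<in> sets M"
      by (intro sets.sets_Collect_finite_All'[OF hit] compact_cball F(1))
        (use F(2) in \<open>simp add: nonempty_compacts_def\<close>)
    ultimately show ?thesis using hit_open[OF \<open>open ?W\<close>] by auto
  qed
  fix \<U> :: "'a set set" assume "\<U> \<in> {U. openin Hausdorff.mtopology U}"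
  then obtain \<F> where \<F>: "countable \<F>"
    "\<And>F r. (F, r) \<in> \<F> \<Longrightarrow> finite F \<and> F \<in> nonempty_compacts"
    "\<U> = (\<Union>(F, r)\<in>\<F>. Hausdorff.mcball F r)"
    using openin_hausdorff_eq_countable_Union[of \<U>] by auto
  have "h -` \<U> \<inter> space M = (\<Union>(F, r)\<in>\<F>. h -` Hausdorff.mcball F r \<inter> space M)"
    unfolding \<F>(3) by auto
  also have "\<dots> \<in> sets M"
    using \<F>(2) ball by (intro sets.countable_UN'[OF \<F>(1)]) auto
  finally show "h -` \<U> \<inter> space M \<in> sets M" .
qed

lemma SUP_cmod_polynomial_less_iff:
  assumes "Q \<in> nonempty_compacts" "p \<in> complex_polynomials"
  shows "(SUP x\<in>Q. cmod (p x)) < c \<longleftrightarrow> (\<forall>x\<in>Q. cmod (p x) < c)"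
  using SUP_cmod_polynomial_attained[OF assms] by force

lemma subset_polynomial_hull:
  assumes "Q \<in> nonempty_compacts"
  shows "Q \<subseteq> polynomial_hull Q"
  using SUP_cmod_polynomial_attained[OF assms] by (force simp: polynomial_hull_def)

lemma coordinate_in_complex_polynomials: "(\<lambda>z :: complex ^ 'n. z $ i) \<in> complex_polynomials"
proof -
  have "(\<Prod>j\<in>UNIV. (z $ j) ^ (if j = i then 1 else 0)) = z $ i" for z :: "complex ^ 'n"
    by (simp add: if_distrib[of "power _"] cong: if_cong)
  then show ?thesis
    unfolding complex_polynomials_def
    by (intro CollectI exI[of _ "{\<lambda>j. if j = i then 1 else 0}"] exI[of _ "\<lambda>_. 1"]) auto
qed

text \<open>The hull is an intersection of closed sublevel sets, is bounded because the coordinates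
  are themselves polynomials, and contains \<open>Q\<close>.\<close>

lemma polynomial_hull_nonempty_compact:
  assumes Q: "Q \<in> nonempty_compacts"
  shows "polynomial_hull Q \<in> nonempty_compacts"
proof -
  have "polynomial_hull Q =
    (\<Inter>p\<in>complex_polynomials. {z. cmod (p z) \<le> (SUP x\<in>Q. cmod (p x))})"
    by (auto simp: polynomial_hull_def)
  also have "closed \<dots>"
    by (intro closed_INT ballI closed_Collect_le continuous_intros continuous_on_complex_polynomials)
  finally have "closed (polynomial_hull Q)" .
  moreover have "norm z \<le> (\<Sum>i\<in>UNIV. SUP x\<in>Q. cmod (x $ i))" if "z \<in> polynomial_hull Q" for z
  proof -
    have "norm z \<le> (\<Sum>i\<in>UNIV. cmod (z $ i))"
      unfolding norm_vec_def by (rule L2_set_le_sum) simp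
    also have "\<dots> \<le> (\<Sum>i\<in>UNIV. SUP x\<in>Q. cmod (x $ i))"
      using that bspec[OF _ coordinate_in_complex_polynomials]
      by (intro sum_mono) (simp add: polynomial_hull_def)
    finally show ?thesis .
  qed
  then have "bounded (polynomial_hull Q)" by (auto simp: bounded_iff)
  ultimately show ?thesis
    using subset_polynomial_hull[OF Q] Q by (auto simp: nonempty_compacts_def compact_eq_bounded_closed)
qed

lemma openin_polynomial_hull_disjoint:
  fixes C :: "(complex ^ 'n) set"
  assumes "compact C"
  shows "openin Hausdorff.mtopology {Q \<in> nonempty_compacts. polynomial_hull Q \<inter> C = {}}"
proof (subst openin_subopen, intro ballI)
  fix Q assume "Q \<in> {Q \<in> nonempty_compacts. polynomial_hull Q \<inter> C = {}}"
  then have Q: "Q \<in> nonempty_compacts" "polynomial_hull Q \<inter> C = {}" by auto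
  \<comment> \<open>The threshold \<open>c\<close> lies strictly between the two values, so both
    inequalities are open conditions and persist near \<open>z\<close> and near
    \<open>Q\<close>.\<close>
  have "\<exists>p c. p \<in> complex_polynomials \<and> (SUP x\<in>Q. cmod (p x)) < c \<and> c < cmod (p z)"
    if "z \<in> C" for z
    using that Q(2) dense by (force simp: polynomial_hull_def disjoint_iff not_le)
  then obtain p c where pc: "\<And>z. z \<in> C \<Longrightarrow> p z \<in> complex_polynomials"
    "\<And>z. z \<in> C \<Longrightarrow> (SUP x\<in>Q. cmod (p z x)) < c z" "\<And>z. z \<in> C \<Longrightarrow> c z < cmod (p z z)"
    by metis
  have "open {w. c z < cmod (p z w)}" if "z \<in> C" for z
    using pc(1)[OF that]
    by (intro open_Collect_less continuous_intros continuous_on_complex_polynomials)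
  moreover have "C \<subseteq> (\<Union>z\<in>C. {w. c z < cmod (p z w)})" using pc(3) by blast
  ultimately obtain Z where Z: "Z \<subseteq> C" "finite Z" "C \<subseteq> (\<Union>z\<in>Z. {w. c z < cmod (p z w)})"
    by (rule compactE_image[OF assms])
  \<comment> \<open>\<open>W\<close> is open as a finite intersection. On a compact subset of
    \<open>W\<close> each chosen polynomial attains its maximum modulus, which is therefore still
    below \<open>c z\<close>.\<close>
  define W where "W = (\<Inter>z\<in>Z. {x. cmod (p z x) < c z})"
  have "open W"
    unfolding W_def using Z(1,2) pc(1)
    by (intro open_INT ballI open_Collect_less continuous_intros continuous_on_complex_polynomials) auto
  have "Q \<subseteq> W"
    using pc(1,2) Z(1) SUP_cmod_polynomial_less_iff[OF Q(1)] by (fastforce simp: W_def)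
  moreover have "polynomial_hull R \<inter> C = {}" if R: "R \<in> nonempty_compacts" "R \<subseteq> W" for R
  proof -
    have "w \<notin> polynomial_hull R" if "w \<in> C" for w
    proof -
      obtain z where z: "z \<in> Z" "c z < cmod (p z w)" using Z(3) \<open>w \<in> C\<close> by blast
      then have "p z \<in> complex_polynomials" using Z(1) pc(1) by blast
      moreover from this have "(SUP x\<in>R. cmod (p z x)) < c z"
        using SUP_cmod_polynomial_less_iff[OF R(1)] R(2) z(1) by (auto simp: W_def)
      ultimately show ?thesis using z(2) by (force simp: polynomial_hull_def)
    qed
    then show ?thesis by blast
  qed
  ultimately show "\<exists>T. openin Hausdorff.mtopology T \<and> Q \<in> T \<and>
      T \<subseteq> {Q \<in> nonempty_compacts. polynomial_hull Q \<inter> C = {}}"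
    using openin_nonempty_compacts_subset[OF \<open>open W\<close>] Q(1)
    by (intro exI[of _ "{Q \<in> nonempty_compacts. Q \<subseteq> W}"]) auto
qed

lemma measurable_polynomial_hull: "polynomial_hull \<in> measurable hausdorff_borel hausdorff_borel"
proof (rule measurable_hausdorff_borelI)
  fix C :: "(complex ^ 'n) set" assume "compact C"
  then have "{Q \<in> nonempty_compacts. polynomial_hull Q \<inter> C = {}} \<in> sets hausdorff_borel"
    unfolding sets_hausdorff_borel by (intro sigma_sets.Basic CollectI openin_polynomial_hull_disjoint)
  \<comment> \<open>The hitting event is the complement of the open set of compact sets whose hull
    misses \<open>C\<close>.\<close>
  then have "space hausdorff_borel - {Q \<in> nonempty_compacts. polynomial_hull Q \<inter> C = {}}
      \<in> sets hausdorff_borel"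
    by blast
  also have "space hausdorff_borel - {Q \<in> nonempty_compacts. polynomial_hull Q \<inter> C = {}} =
      {Q \<in> space hausdorff_borel. polynomial_hull Q \<inter> C \<noteq> {}}"
    by auto
  finally show "{Q \<in> space hausdorff_borel. polynomial_hull Q \<inter> C \<noteq> {}} \<in> sets hausdorff_borel" .
qed (simp add: polynomial_hull_nonempty_compact)

theorem theorem4p12:
  fixes M :: "'w measure" and K :: "'w \<Rightarrow> (complex ^ 'n) set"
  assumes "random_compact_set M K"
  shows "random_compact_set M (\<lambda>\<omega>. polynomial_hull (K \<omega>))"
  using assms measurable_polynomial_hull unfolding random_compact_set_def by (rule measurable_compose)

end
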